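(* Let $\delta_1,\delta_2>0$. Suppose that in the quantum winning strategy for the Mermin-GHZ game Alice (player 1) performs both transformations $U$ and $H$ imperfectly with random errors with bounds $\delta_1$ and $\delta_2$, respectively (i.e. she applies $U_{\epsilon_1}$ in place of $U$ and $H_{\epsilon_2}$ in place of $H$, where $\epsilon_1$ and $\epsilon_2$ are independent and uniformly distributed on $[-\delta_1,\delta_1]$ and $[-\delta_2,\delta_2]$ respectively), all other steps being performed correctly. Then for any inputs $x_1,x_2,x_3\in\{0,1\}$ satisfying the promise $x_1\oplus x_2\oplus x_3=0$, the strategy gives a correct answer with probability $$P_{\delta}(x_1,x_2,x_3)=\begin{cases}\dfrac{1}{2\delta_2}\left(\delta_2+\sin^{2}\left(\frac{\pi}{4}+\frac{\delta_2}{2}\right)-\sin^{2}\left(\frac{\pi}{4}-\frac{\delta_2}{2}\right)\right) & \text{if } x_1=0,\\[8pt] \dfrac{\sin\delta_1\left(\sin^{2}\left(\frac{\pi}{4}+\frac{\delta_2}{2}\right)-\sin^{2}\left(\frac{\pi}{4}-\frac{\delta_2}{2}\right)\right)+\delta_1\delta_2}{2\delta_1\delta_2} & \text{otherwise.}\end{cases}$$ Moreover, for a question $(x_1,x_2,x_3)$ chosen uniformly at random from the promise set $P$, it gives a correct answer with probability $$P_{\delta}=\frac14\left(1+\frac{\sin^{2}\left(\frac{\pi}{4}+\frac{\delta_2}{2}\right)-\sin^{2}\left(\frac{\pi}{4}-\frac{\delta_2}{2}\right)}{\delta_2}+\frac{\sin\delta_1\left(\sin^{2}\left(\frac{\pi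}{4}+\frac{\delta_2}{2}\right)-\sin^{2}\left(\frac{\pi}{4}-\frac{\delta_2}{2}\right)\right)+\delta_1\delta_2}{\delta_1\delta_2}\right).$$
   Context: Mermin-GHZ game: three players, Alice, Bob and Charles (players 1, 2, 3), receive input bits $x_1,x_2,x_3\in\{0,1\}$ respectively, with the promise that $(x_1,x_2,x_3)\in P=\{(x_1,x_2,x_3)\in\{0,1\}^3 : x_1\oplus x_2\oplus x_3=0\}$. Without communicating, they output bits $a_1,a_2,a_3$ respectively. The answer is correct if $a_1\oplus a_2\oplus a_3=x_1\lor x_2\lor x_3$. Quantum winning strategy: the players share the three-qubit state $|\varphi\rangle=\frac{1}{\sqrt2}(|000\rangle+|111\rangle)$, player $i$ holding the $i$-th qubit. On input $x_i$, player $i$ (1) applies to his or her qubit the unitary $U$ given by $U|0\rangle=|0\rangle$, $U|1\rangle=e^{\pi \imath x_i/2}|1\rangle$; (2) applies the Hadamard transformation $H=\frac{1}{\sqrt2}\begin{pmatrix}1&1\\1&-1\end{pmatrix}$; (3) measures the qubit in the computational basis and outputs the measured bit $a_i$. Here $\imath$ is the imaginary unit. Random errors with bounds $\delta_1,\delta_2$ in Alice's transformations: $\epsilon_1$ and $\epsilon_2$ are chosen independently and uniformly at random from $[-\delta_1,\delta_1]$ and $[-\delta_2,\delta_2]$ respectively; in step (1) Alice applies instead of $U$ the unitary $U_{\epsilon_1}$ given by $U_{\epsilon_1}|0\rangle=|0\rangle$, $U_{\epsilon_1}|1\rangle=e^{(\frac{\pi}{2}+\epsilon_1)\imath x_1}|1\rangle$,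 and in step (2) she applies instead of $H$ the unitary $$H_{\epsilon_2}=\begin{pmatrix}\cos(\frac{\pi}{4}+\frac{\epsilon_2}{2}) & \sin(\frac{\pi}{4}+\frac{\epsilon_2}{2})\\ \sin(\frac{\pi}{4}+\frac{\epsilon_2}{2}) & -\cos(\frac{\pi}{4}+\frac{\epsilon_2}{2})\end{pmatrix}$$ (matrix in the computational basis $|0\rangle,|1\rangle$); everything else is unchanged. The probability of a correct answer is taken over both the choice of $(\epsilon_1,\epsilon_2)$ and the measurement outcomes (and, for $P_\delta$, over the uniformly random question, chosen independently of $(\epsilon_1,\epsilon_2)$). *)

theory Defs
  imports "HOL-Probability.Probability"
begin

text \<open>
  Bits are Booleans, with \<open>False\<close> for 0 and \<open>True\<close> for 1; triples are ordered Alice, Bob, Charles.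
  They also index the computational bases of one and of three qubits.
\<close>

type_synonym bits3 = "bool \<times> bool \<times> bool"
type_synonym qop = "complex ^ bool ^ bool"
type_synonym state3 = "complex ^ bits3"

definition bit_xor :: "bool \<Rightarrow> bool \<Rightarrow> bool"  (infixl "[+]" 65)
  where "a [+] b \<longleftrightarrow> a \<noteq> b"

definition promise :: "bits3 set"
  where "promise = {(x1, x2, x3). (x1 [+] x2 [+] x3) = False}"

fun correct :: "bits3 \<Rightarrow> bits3 \<Rightarrow> bool"
  where "correct (x1, x2, x3) (a1, a2, a3) \<longleftrightarrow> (a1 [+] a2 [+] a3) = (x1 \<or> x2 \<or> x3)"

definition mat2 :: "complex \<Rightarrow> complex \<Rightarrow> complex \<Rightarrow> complex \<Rightarrow> qop"
  where "mat2 a b c d =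
    (\<chi> i j. if \<not> i then (if \<not> j then a else b) else (if \<not> j then c else d))"

definition tensor3 :: "qop \<Rightarrow> qop \<Rightarrow> qop \<Rightarrow> complex ^ bits3 ^ bits3"
  where "tensor3 A B C = (\<chi> i j. case (i, j) of ((i1, i2, i3), (j1, j2, j3)) \<Rightarrow>
    A $ i1 $ j1 * B $ i2 $ j2 * C $ i3 $ j3)"

definition ghz :: state3
  where "ghz = (1 / complex_of_real (sqrt 2)) *s
    (axis (False, False, False) 1 + axis (True, True, True) 1)"

definition U_gate :: "bool \<Rightarrow> qop"
  where "U_gate x = mat2 1 0 0 (exp (complex_of_real pi * \<i> * of_bool x / 2))"

definition H_gate :: qop
  where "H_gate = (let r = 1 / complex_of_real (sqrt 2) in mat2 r r r (- r))"

definition U_err :: "real \<Rightarrow> bool \<Rightarrow> qop"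
  where "U_err \<epsilon> x = mat2 1 0 0 (exp (complex_of_real (pi / 2 + \<epsilon>) * \<i> * of_bool x))"

definition H_err :: "real \<Rightarrow> qop"
  where "H_err \<epsilon> = (let c = complex_of_real (cos (pi / 4 + \<epsilon> / 2));
                       s = complex_of_real (sin (pi / 4 + \<epsilon> / 2))
                   in mat2 c s s (- c))"

fun final_state :: "real \<Rightarrow> real \<Rightarrow> bits3 \<Rightarrow> state3"
  where "final_state \<epsilon>1 \<epsilon>2 (x1, x2, x3) =
    tensor3 (H_err \<epsilon>2) H_gate H_gate *v
      (tensor3 (U_err \<epsilon>1 x1) (U_gate x2) (U_gate x3) *v ghz)"

text \<open>
  The Born rule. The value of \<open>embed_pmf\<close> is meaningful only for a unit vector, which is
  what \<open>final_state_normalized\<close> below provides.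
\<close>

definition measure_qubits :: "state3 \<Rightarrow> bits3 pmf"
  where "measure_qubits \<psi> = embed_pmf (\<lambda>a. (cmod (\<psi> $ a))\<^sup>2)"

definition uniform_error :: "real \<Rightarrow> real measure"
  where "uniform_error \<delta> = uniform_measure lborel {- \<delta>..\<delta>}"

text \<open>The distribution of the players' outputs on a fixed question.\<close>

definition answers :: "real \<Rightarrow> real \<Rightarrow> bits3 \<Rightarrow> bits3 measure"
  where "answers \<delta>1 \<delta>2 x =
    (uniform_error \<delta>1 \<Otimes>\<^sub>M uniform_error \<delta>2) \<bind>
      (\<lambda>(\<epsilon>1, \<epsilon>2). measure_pmf (measure_qubits (final_state \<epsilon>1 \<epsilon>2 x)))"

text \<open>The joint distribution of a uniformly random question and the outputs on it.\<close>

definition random_round :: "real \<Rightarrow> real \<Rightarrow> (bits3 \<times> bits3) measure"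
  where "random_round \<delta>1 \<delta>2 =
    measure_pmf (pmf_of_set promise) \<bind>
      (\<lambda>x. answers \<delta>1 \<delta>2 x \<bind> (\<lambda>a. return (count_space UNIV) (x, a)))"

lemma UNIV_bits3: "(UNIV :: bits3 set) =
  {(False, False, False), (False, False, True), (False, True, False), (False, True, True),
   (True, False, False), (True, False, True), (True, True, False), (True, True, True)}"
  by (auto simp: UNIV_bool)

lemma ghz_nth: "ghz $ a = (if a = (False,False,False) \<or> a = (True,True,True) then 1 / complex_of_real (sqrt 2) else 0)"
  by (auto simp: ghz_def axis_def)

lemma final_state_nth: "final_state \<epsilon>1 \<epsilon>2 (x1,x2,x3) $ (a1,a2,a3) = 
  (1 / complex_of_real (sqrt 2)) * (H_err \<epsilon>2 $ a1 $ False * H_gate $ a2 $ False * H_gate $ a3 $ False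
   + H_err \<epsilon>2 $ a1 $ True * H_gate $ a2 $ True * H_gate $ a3 $ True * 
    (U_err \<epsilon>1 x1 $ True $ True * U_gate x2 $ True $ True * U_gate x3 $ True $ True))"
  apply (simp add: matrix_vector_mult_def tensor3_def ghz_nth UNIV_bits3)
  apply (simp add: U_err_def U_gate_def mat2_def ring_distribs add_divide_distrib mult.assoc)
  done

lemma gate_phase: "U_err \<epsilon> x $ True $ True = (if x then \<i> * cis \<epsilon> else 1)"
  "U_gate x $ True $ True = (if x then \<i> else 1)"
  by (auto simp: U_err_def U_gate_def mat2_def exp_add ring_distribs mult.commute exp_eq_polar cis_mult[symmetric])

lemma cis_Complex: "cis e = Complex (cos e) (sin e)" by (simp add: complex_eq_iff)

lemma final_state_normalized: "(\<Sum>a\<in>UNIV. (cmod (final_state \<epsilon>1 \<epsilon>2 x $ a))\<^sup>2) = 1" 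
proof -
  obtain x1 x2 x3 where x: "x = (x1, x2, x3)" by (cases x)
  define c where "c = cos (pi / 4 + \<epsilon>2 / 2)"
  define s where "s = sin (pi / 4 + \<epsilon>2 / 2)"
  have H: "H_err \<epsilon>2 = mat2 (of_real c) (of_real s) (of_real s) (- of_real c)" by (simp add: H_err_def c_def s_def Let_def)
  have 1: "c^2 + s^2 = 1" by (simp add: c_def s_def)
  have 0: "(sqrt 2)^2 = (2::real)" by simp
  have 2: "cos \<epsilon>1 ^2 + sin \<epsilon>1 ^2 = 1" by simp
  have q: "sqrt 2 * (sqrt 2 * x) = 2 * x" for x :: real by (simp flip: mult.assoc)
  have A: "c * c * (sin \<epsilon>1 * sin \<epsilon>1) + c * c * (cos \<epsilon>1 * cos \<epsilon>1) = c * c" using 2 by algebra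
  have B: "s * s * (sin \<epsilon>1 * sin \<epsilon>1) + s * s * (cos \<epsilon>1 * cos \<epsilon>1) = s * s" using 2 by algebra
  have D: "c * c + s * s = 1" using 1 by algebra
  show ?thesis unfolding x
  apply (cases x1; cases x2; cases x3) 
  apply (simp_all del: final_state.simps add: UNIV_bits3 final_state_nth gate_phase cmod_power2 H H_gate_def Let_def mat2_def cis_Complex Re_divide Im_divide power_divide field_simps)
  by (use A B D in \<open>simp_all add: power2_eq_square algebra_simps q\<close>)
qed

lemma pmf_measure_qubits:
  "pmf (measure_qubits (final_state \<epsilon>1 \<epsilon>2 x)) a = (cmod (final_state \<epsilon>1 \<epsilon>2 x $ a))\<^sup>2"
  unfolding measure_qubits_def
  by (rule pmf_embed_pmf)
    (simp_all add: nn_integral_count_space_finite sum_ennreal final_state_normalized)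

end

theory Submission
  imports Defs
begin

text \<open>
  For fixed errors the Born rule gives the success probability \<open>(1 + g \<epsilon>1 * cos \<epsilon>2) / 2\<close>, where
  \<open>g\<close> is \<open>cos\<close> if \<open>x1 = 1\<close> and constantly 1 otherwise. As the errors are independent, averaging
  factorises, and \<open>cos\<close> has mean \<open>sin \<delta> / \<delta>\<close> over \<open>[-\<delta>, \<delta>]\<close>. The difference of squared
  sines in the theorem is \<open>sin \<delta>2\<close>, and exactly two of the four questions have \<open>x1 = 1\<close>.
\<close>

text \<open>On the promise, the factors \<open>\<i>\<close> of the three phase gates multiply to 1
  or -1, leaving at most \<open>cis \<epsilon>1\<close>. Each of the four correct outcomes then has
  probability 1/8 of \<open>1 + 2 * c * s * g \<epsilon>1\<close>: the sign of the interference term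
  is always the favourable one.\<close>

lemma correct_measure_final_state:
  assumes "(x1, x2, x3) \<in> promise"
  shows "measure (measure_pmf (measure_qubits (final_state \<epsilon>1 \<epsilon>2 (x1, x2, x3)))) {a. correct (x1, x2, x3) a}
    = (1 + (if x1 then cos \<epsilon>1 else 1) * cos \<epsilon>2) / 2"
proof -
  define c where "c = cos (pi / 4 + \<epsilon>2 / 2)"
  define s where "s = sin (pi / 4 + \<epsilon>2 / 2)"
  have H: "H_err \<epsilon>2 = mat2 (of_real c) (of_real s) (of_real s) (- of_real c)"
    by (simp add: H_err_def c_def s_def Let_def)
  have q: "sqrt 2 * (sqrt 2 * x) = 2 * x" for x :: real
    by (simp flip: mult.assoc)
  \<comment> \<open>The doubled angle is pi/2 + \<open>\<epsilon>2\<close>, which turns the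
    interference factor into a cosine.\<close>
  have "2 * s * c = sin (2 * (pi / 4 + \<epsilon>2 / 2))"
    unfolding s_def c_def sin_double by simp
  also have "\<dots> = cos \<epsilon>2"
    by (simp add: distrib_left sin_add)
  finally have cos2: "cos \<epsilon>2 = 2 * (c * s)"
    by (simp only: mult.assoc mult.commute[of s c])
  have cs: "c * c + s * s = 1"
    using sin_cos_squared_add3[of "pi / 4 + \<epsilon>2 / 2"] by (simp add: c_def s_def)
  have trig: "cos \<epsilon>1 ^ 2 + sin \<epsilon>1 ^ 2 = 1"
    by simp
  \<comment> \<open>Pythagoras in the expanded form that \<open>algebra_simps\<close> produces,
    where \<open>c * c\<close> is no longer factored out.\<close>
  have A: "c * c * (sin \<epsilon>1 * sin \<epsilon>1) + c * c * (cos \<epsilon>1 * cos \<epsilon>1) = c * c"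
    using trig by algebra
  have B: "s * s * (sin \<epsilon>1 * sin \<epsilon>1) + s * s * (cos \<epsilon>1 * cos \<epsilon>1) = s * s"
    using trig by algebra
  have "measure (measure_pmf (measure_qubits (final_state \<epsilon>1 \<epsilon>2 (x1, x2, x3)))) {a. correct (x1, x2, x3) a}
    = (\<Sum>a\<in>UNIV. if correct (x1, x2, x3) a then (cmod (final_state \<epsilon>1 \<epsilon>2 (x1, x2, x3) $ a))\<^sup>2 else 0)"
    by (simp add: measure_measure_pmf_finite pmf_measure_qubits sum.If_cases del: final_state.simps)
  also have "\<dots> = (1 + (if x1 then cos \<epsilon>1 else 1) * cos \<epsilon>2) / 2"
    \<comment> \<open>With \<open>cos \<epsilon>2\<close> eliminated, the promise cases become
      polynomial identities in \<open>c\<close>, \<open>s\<close>, \<open>cos \<epsilon>1\<close>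
      and \<open>sin \<epsilon>1\<close>; the other inputs contradict the assumption.\<close>
    using assms unfolding cos2
    apply (cases x1; cases x2; cases x3)
    apply (simp_all del: final_state.simps add: promise_def bit_xor_def UNIV_bits3 final_state_nth
        gate_phase cmod_power2 H H_gate_def Let_def mat2_def cis_Complex Re_divide Im_divide
        power_divide field_simps)
    by (use A B cs in \<open>simp_all add: power2_eq_square algebra_simps q\<close>)
  finally show ?thesis .
qed

text \<open>Each outcome probability is the squared modulus of an amplitude that is continuous in
  the errors. Only the entries of Alice's gates vary, and \<open>a1\<close> and \<open>x1\<close>
  select them.\<close>

lemma borel_measurable_pmf_final_state:
  "(\<lambda>\<epsilon>. pmf (measure_qubits (final_state (fst \<epsilon>) (snd \<epsilon>) x)) a) \<in> borel_measurable borel"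
proof -
  obtain x1 x2 x3 a1 a2 a3 where "x = (x1, x2, x3)" "a = (a1, a2, a3)"
    by (cases x, cases a) auto
  then show ?thesis
    unfolding pmf_measure_qubits
    by (cases a1; cases x1)
      (auto simp: final_state_nth gate_phase H_err_def mat2_def Let_def cis_conv_exp
        simp del: final_state.simps
        intro!: borel_measurable_continuous_onI continuous_intros)
qed

lemma measurable_measure_final_state:
  "(\<lambda>(\<epsilon>1, \<epsilon>2). measure_pmf (measure_qubits (final_state \<epsilon>1 \<epsilon>2 x)))
    \<in> borel \<rightarrow>\<^sub>M subprob_algebra (count_space UNIV)"
proof (rule measurable_subprob_algebra)
  fix A :: "bits3 set"
  show "(\<lambda>\<epsilon>. emeasure (case \<epsilon> of (\<epsilon>1, \<epsilon>2) \<Rightarrow>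
      measure_pmf (measure_qubits (final_state \<epsilon>1 \<epsilon>2 x))) A) \<in> borel_measurable borel"
    by (auto simp: split_beta emeasure_measure_pmf_finite simp del: final_state.simps
        intro!: measurable_compose[OF _ measurable_ennreal]
          borel_measurable_sum[OF borel_measurable_pmf_final_state])
qed (auto simp: split_beta intro: prob_space_imp_subprob_space prob_space_measure_pmf)

lemma sets_uniform_error [simp, measurable_cong]: "sets (uniform_error \<delta>) = sets borel"
  by (simp add: uniform_error_def)

text \<open>Measurability sees only the sigma-algebras, and that of the product is the Borel one on
  the plane.\<close>

lemma measurable_measure_final_state_uniform_error:
  "(\<lambda>(\<epsilon>1, \<epsilon>2). measure_pmf (measure_qubits (final_state \<epsilon>1 \<epsilon>2 x)))
    \<in> uniform_error \<delta>1 \<Otimes>\<^sub>M uniform_error \<delta>2 \<rightarrow>\<^sub>M subprob_algebra (count_space UNIV)"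
proof -
  have "sets (uniform_error \<delta>1 \<Otimes>\<^sub>M uniform_error \<delta>2) = sets borel"
    by (simp add: borel_prod[symmetric] cong: sets_pair_measure_cong)
  then show ?thesis
    using measurable_measure_final_state by (simp cong: measurable_cong_sets)
qed

lemma prob_space_uniform_error: "\<delta> > 0 \<Longrightarrow> prob_space (uniform_error \<delta>)"
  unfolding uniform_error_def by (intro prob_space_uniform_measure) auto

lemma integral_cos_uniform_error:
  assumes "\<delta> > 0"
  shows "(\<integral>x. cos x \<partial>uniform_error \<delta>) = sin \<delta> / \<delta>"
proof -
  \<comment> \<open>The quotient in \<open>uniform_measure\<close> is taken in
    \<open>ennreal\<close>; \<open>integral_density\<close> wants a real-valued density.\<close>
  have "uniform_error \<delta> = density lborel (\<lambda>x. ennreal (indicator {-\<delta>..\<delta>} x / (2 * \<delta>)))"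
    unfolding uniform_error_def uniform_measure_def using assms
    by (intro density_cong) (auto simp: indicator_def divide_ennreal ennreal_1[symmetric] simp del: ennreal_1)
  then have "(\<integral>x. cos x \<partial>uniform_error \<delta>) = (\<integral>x. (indicator {-\<delta>..\<delta>} x / (2 * \<delta>)) * cos x \<partial>lborel)"
    using assms by (simp add: integral_density)
  also have "\<dots> = (\<integral>x. cos x * indicator {-\<delta>..\<delta>} x \<partial>lborel) / (2 * \<delta>)"
    by (simp add: mult.commute)
  also have "(\<integral>x. cos x * indicator {-\<delta>..\<delta>} x \<partial>lborel) = sin \<delta> - sin (-\<delta>)"
    using assms by (intro integral_FTC_Icc_real) (auto intro!: derivative_eq_intros)
  finally show ?thesis
    by (simp add: field_simps)
qed

lemma prob_correct_answers:
  assumes "\<delta>1 > 0" "\<delta>2 > 0" and x: "(x1, x2, x3) \<in> promise"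
  shows "measure (answers \<delta>1 \<delta>2 (x1, x2, x3)) {a. correct (x1, x2, x3) a}
    = (1 + (if x1 then sin \<delta>1 / \<delta>1 else 1) * (sin \<delta>2 / \<delta>2)) / 2"
proof -
  let ?M = "uniform_error \<delta>1" and ?N = "uniform_error \<delta>2"
  interpret M: prob_space ?M by (rule prob_space_uniform_error[OF assms(1)])
  interpret N: prob_space ?N by (rule prob_space_uniform_error[OF assms(2)])
  interpret MN: pair_prob_space ?M ?N ..
  define g :: "real \<Rightarrow> real" where "g = (if x1 then cos else (\<lambda>_. 1))"
  have [measurable]: "g \<in> borel_measurable borel"
    by (simp add: g_def)
  have g_bound: "\<bar>g e\<bar> \<le> 1" for e
    by (simp add: g_def)
  \<comment> \<open>Bounded on a probability space; Fubini below relies on this.\<close>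
  have int: "integrable (?M \<Otimes>\<^sub>M ?N) (\<lambda>(e1, e2). g e1 * cos e2)"
    by (rule MN.integrable_const_bound[where B = 1])
      (auto simp: split_beta abs_mult intro!: mult_le_one g_bound)
  have "measure (answers \<delta>1 \<delta>2 (x1, x2, x3)) {a. correct (x1, x2, x3) a}
    = (\<integral>\<epsilon>. measure (case \<epsilon> of (\<epsilon>1, \<epsilon>2) \<Rightarrow>
        measure_pmf (measure_qubits (final_state \<epsilon>1 \<epsilon>2 (x1, x2, x3)))) {a. correct (x1, x2, x3) a}
          \<partial>(?M \<Otimes>\<^sub>M ?N))"
    unfolding answers_def
    by (rule MN.measure_bind[OF measurable_measure_final_state_uniform_error]) simp
  also have "\<dots> = (\<integral>\<epsilon>. 1 / 2 + (case \<epsilon> of (e1, e2) \<Rightarrow> g e1 * cos e2) / 2 \<partial>(?M \<Otimes>\<^sub>M ?N))"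
    by (simp only: split_beta correct_measure_final_state[OF x])
      (simp add: g_def add_divide_distrib if_distrib cong: if_cong)
  also have "\<dots> = 1 / 2 + (\<integral>\<epsilon>. (case \<epsilon> of (e1, e2) \<Rightarrow> g e1 * cos e2) \<partial>(?M \<Otimes>\<^sub>M ?N)) / 2"
    using int by (simp add: MN.prob_space)
  also have "(\<integral>\<epsilon>. (case \<epsilon> of (e1, e2) \<Rightarrow> g e1 * cos e2) \<partial>(?M \<Otimes>\<^sub>M ?N))
    = (\<integral>e1. \<integral>e2. g e1 * cos e2 \<partial>?N \<partial>?M)"
    using MN.integral_fst'[OF int] by simp
  also have "\<dots> = (\<integral>e. g e \<partial>?M) * (\<integral>e. cos e \<partial>?N)"
    by simp
  also have "(\<integral>e. g e \<partial>?M) = (if x1 then sin \<delta>1 / \<delta>1 else 1)"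
    using assms by (simp add: g_def integral_cos_uniform_error M.prob_space)
  finally show ?thesis
    using assms by (simp add: integral_cos_uniform_error add_divide_distrib)
qed

text \<open>Lets \<open>answers\<close> serve as the inner measure of the binds in
  \<open>random_round\<close>.\<close>

lemma answers_in_subprob_algebra:
  assumes "\<delta>1 > 0" "\<delta>2 > 0"
  shows "answers \<delta>1 \<delta>2 x \<in> space (subprob_algebra (count_space UNIV))"
proof -
  let ?M = "uniform_error \<delta>1" and ?N = "uniform_error \<delta>2"
  interpret M: prob_space ?M by (rule prob_space_uniform_error[OF assms(1)])
  interpret N: prob_space ?N by (rule prob_space_uniform_error[OF assms(2)])
  interpret MN: pair_prob_space ?M ?N ..
  note K = measurable_measure_final_state_uniform_error[of x \<delta>1 \<delta>2]
  show ?thesis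
    unfolding answers_def space_subprob_algebra
    using subprob_space_bind[OF MN.subprob_space_axioms K] sets_bind[OF sets_kernel[OF K] MN.not_empty]
    by simp
qed

text \<open>Conditioning on the question: given \<open>x\<close>, the pair lies in the slice over
  \<open>x\<close>, so the event has the probability of its section there.\<close>

lemma prob_correct_random_round:
  assumes "\<delta>1 > 0" "\<delta>2 > 0"
  shows "measure (random_round \<delta>1 \<delta>2) {(x, a). correct x a}
    = (\<Sum>x\<in>promise. measure (answers \<delta>1 \<delta>2 x) {a. correct x a}) / card promise"
proof -
  define K where "K = (\<lambda>x. answers \<delta>1 \<delta>2 x \<bind> (\<lambda>a. return (count_space UNIV) (x, a)))"
  have sub: "subprob_space (answers \<delta>1 \<delta>2 x)" "sets (answers \<delta>1 \<delta>2 x) = sets (count_space UNIV)" for x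
    using answers_in_subprob_algebra[OF assms, of x] by (auto simp: space_subprob_algebra)
  have ret: "(\<lambda>a. return (count_space UNIV) (x, a))
      \<in> answers \<delta>1 \<delta>2 x \<rightarrow>\<^sub>M subprob_algebra (count_space (UNIV :: (bits3 \<times> bits3) set))" for x
    by (simp add: measurable_cong_sets[OF sub(2) refl] space_subprob_algebra
        prob_space_imp_subprob_space prob_space_return)
  \<comment> \<open>A bind from an empty space defaults to \<open>count_space {}\<close>, so
    \<open>sets_bind\<close> needs non-emptiness.\<close>
  have ne: "space (answers \<delta>1 \<delta>2 x) \<noteq> {}" for x
    using sub(1) by (rule subprob_space.subprob_not_empty)
  have K: "K \<in> measure_pmf (pmf_of_set promise) \<rightarrow>\<^sub>M subprob_algebra (count_space UNIV)"
    unfolding K_def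
    by (auto simp: space_subprob_algebra subprob_space_bind[OF sub(1) ret]
        sets_bind[OF sets_kernel[OF ret] ne])
  have K_correct: "measure (K x) {(x, a). correct x a} = measure (answers \<delta>1 \<delta>2 x) {a. correct x a}" for x
  proof -
    have "measure (K x) {(x, a). correct x a}
      = (\<integral>a. measure (return (count_space UNIV) (x, a)) {(x, a). correct x a} \<partial>answers \<delta>1 \<delta>2 x)"
      unfolding K_def by (rule subprob_space.measure_bind[OF sub(1) ret]) simp
    also have "\<dots> = (\<integral>a. indicator {a. correct x a} a \<partial>answers \<delta>1 \<delta>2 x)"
      by (intro Bochner_Integration.integral_cong) (auto simp: measure_return indicator_def)
    also have "\<dots> = measure (answers \<delta>1 \<delta>2 x) {a. correct x a}"
      using sets_eq_imp_space_eq[OF sub(2)[of x]] by simp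
    finally show ?thesis .
  qed
  have "promise \<noteq> {}"
    by (auto simp: promise_def bit_xor_def)
  then show ?thesis
    unfolding random_round_def K_def[symmetric]
    by (subst measure_pmf.measure_bind[OF K]) (simp_all add: K_correct integral_pmf_of_set)
qed

lemma promise_eq: "promise =
  {(False, False, False), (False, True, True), (True, False, True), (True, True, False)}"
  by (auto simp: promise_def bit_xor_def)

text \<open>Sine and cosine agree at pi/4, so the two squares are (1 + sin
  \<open>\<delta>\<close>)/2 and (1 - sin \<open>\<delta>\<close>)/2.\<close>

lemma sin_squared_diff: "(sin (pi / 4 + \<delta> / 2))\<^sup>2 - (sin (pi / 4 - \<delta> / 2))\<^sup>2 = sin (\<delta> :: real)"
proof -
  have "(sin (pi / 4 + \<delta> / 2))\<^sup>2 - (sin (pi / 4 - \<delta> / 2))\<^sup>2 = 2 * sin (\<delta> / 2) * cos (\<delta> / 2)"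
    by (simp add: sin_add sin_diff sin_45 cos_45 power2_eq_square algebra_simps)
  then show ?thesis
    using sin_double[of "\<delta> / 2"] by simp
qed

theorem theorem6:
  fixes \<delta>1 \<delta>2 :: real
  assumes "\<delta>1 > 0" and "\<delta>2 > 0"
  shows "(\<forall>x1 x2 x3. (x1, x2, x3) \<in> promise \<longrightarrow>
      measure (answers \<delta>1 \<delta>2 (x1, x2, x3)) {a. correct (x1, x2, x3) a} =
        (if x1 = False
         then 1 / (2 * \<delta>2) *
           (\<delta>2 + (sin (pi / 4 + \<delta>2 / 2))\<^sup>2 - (sin (pi / 4 - \<delta>2 / 2))\<^sup>2)
         else (sin \<delta>1 * ((sin (pi / 4 + \<delta>2 / 2))\<^sup>2 - (sin (pi / 4 - \<delta>2 / 2))\<^sup>2) + \<delta>1 * \<delta>2) /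
           (2 * \<delta>1 * \<delta>2))) \<and>
    measure (random_round \<delta>1 \<delta>2) {(x, a). correct x a} =
      1 / 4 *
        (1 + ((sin (pi / 4 + \<delta>2 / 2))\<^sup>2 - (sin (pi / 4 - \<delta>2 / 2))\<^sup>2) / \<delta>2 +
         (sin \<delta>1 * ((sin (pi / 4 + \<delta>2 / 2))\<^sup>2 - (sin (pi / 4 - \<delta>2 / 2))\<^sup>2) + \<delta>1 * \<delta>2) /
           (\<delta>1 * \<delta>2))"
proof -
  have "measure (random_round \<delta>1 \<delta>2) {(x, a). correct x a}
    = (\<Sum>(x1, x2, x3)\<in>promise. (1 + (if x1 then sin \<delta>1 / \<delta>1 else 1) * (sin \<delta>2 / \<delta>2)) / 2) / card promise"
    unfolding prob_correct_random_round[OF assms]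
    by (intro arg_cong2[where f = "(/)"] sum.cong refl) (auto simp: prob_correct_answers[OF assms])
  also have "\<dots> = 1 / 4 * (1 + sin \<delta>2 / \<delta>2 + (sin \<delta>1 * sin \<delta>2 + \<delta>1 * \<delta>2) / (\<delta>1 * \<delta>2))"
    unfolding promise_eq using assms by (simp add: field_simps)
  \<comment> \<open>Reversing \<open>add_diff_eq\<close> brackets the two squares together in the
    case \<open>x1 = False\<close>, so that \<open>sin_squared_diff\<close> matches.\<close>
  finally show ?thesis
    using assms unfolding add_diff_eq[symmetric] sin_squared_diff
    by (simp add: prob_correct_answers field_simps)
qed

end
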